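(* Let $\Xi\subset\mathbb{R}^d$ be a polyhedron, $\bm\zeta_0$ a vertex of $\Xi$, $\bm v_1,\ldots,\bm v_L$ the directions of all edges of $\Xi$ incident to $\bm\zeta_0$, and let $\bm W\in\mathbb{R}^{m\times r}$, $\bm H\in\mathbb{R}^{m\times d}$, $\bm b\in\mathbb{R}^m$. The algorithm described in the context, run on the input $(\bm W,\bm H,\bm b,\bm\zeta_0,\{\bm v_1,\ldots,\bm v_L\})$, has the following properties. (a) (Termination) Its while loop terminates in at most $m$ iterations, and the algorithm halts at one of the return statements (R1), (R2) inside the loop or at one of the return statements (R3), (R4) after the loop. (b) (LP count) The algorithm solves at most $(m+2)(m+1)/2$ linear programs, each with at most $rd+r+1$ decision variables and at most $mL+m+1$ constraints, hence of size polynomial in $(m,r,d,L)$. (c) (Correctness) The algorithm returns "locally linear feasible at $\bm\zeta_0$" if and only if the recourse system $\bm W\bm y+\bm H\bm\xi\ge\bm b$ is locally linear feasible at $\bm\zeta_0$.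
   Context: Vector inequalities are componentwise; $[k]=\{1,\ldots,k\}$; $\bm W_i,\bm H_i$ denote the $i$-th rows of $\bm W,\bm H$. An edge is a one-dimensional face, and a direction of an edge incident to $\bm\zeta_0$ is a nonzero vector $\bm v$ such that $\bm\zeta_0+\lambda\bm v$ lies in the edge for all sufficiently small $\lambda>0$ (one direction per edge). Locally linear feasible at $\bm\zeta_0$: there exist $\epsilon>0$ and an affine function $\bm y(\bm\xi)=\bm y_0+\bm Y\bm\xi$ with $\bm y_0\in\mathbb{R}^r$, $\bm Y\in\mathbb{R}^{r\times d}$, such that $\bm W\bm y(\bm\xi)+\bm H\bm\xi\ge\bm b$ for all $\bm\xi\in\Xi\cap B(\bm\zeta_0,\epsilon)$, where $B(\bm\zeta_0,\epsilon)$ is the ball of radius $\epsilon$ centered at $\bm\zeta_0$. For $(\bm Y,\bm y)\in\mathbb{R}^{r\times d}\times\mathbb{R}^r$ and $i\in[m]$ set $R_i(\bm Y,\bm y)=\bm W_i(\bm Y\bm\zeta_0+\bm y)+\bm H_i\bm\zeta_0$. For $\mathcal{E}\subseteq[m]$ let $$\mathcal{G}(\mathcal{E})=\{(\bm Y,\bm y):\ R_i(\bm Y,\bm y)=b_i,\ \bm W_i\bm Y\bm v_\ell+\bm H_i\bm v_\ell\ge0\ \forall\ell\in[L],\ i\in\mathcal{E};\ \ R_i(\bm Y,\bm y)\ge b_i\ \forall i\notin\mathcal{E}\}.$$ LP($\mathcal{E}$) is the linear program $$t^\star_{\mathcal{E}}=\max\ t$$ over $(\bm Y,\bm y)\in\mathbb{R}^{r\times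 d}\times\mathbb{R}^r$ and $t\in\mathbb{R}_+$, subject to $R_i(\bm Y,\bm y)=b_i$ and $\bm W_i\bm Y\bm v_\ell+\bm H_i\bm v_\ell\ge0$ for all $\ell\in[L]$, $i\in\mathcal{E}$, and $R_i(\bm Y,\bm y)\ge b_i+t$ for all $i\notin\mathcal{E}$ (with $t^\star_{\mathcal{E}}=+\infty$ if it is feasible and unbounded). Sub-LP($\mathcal{E},i$) is the linear program $$\sigma^\star_{\mathcal{E},i}=\max\{R_i(\bm Y,\bm y):(\bm Y,\bm y)\in\mathcal{G}(\mathcal{E})\}$$ (with value $+\infty$ if unbounded). Algorithm. Initialize $\mathcal{E}=\emptyset$. While $|\mathcal{E}|<m$: solve LP($\mathcal{E}$). - If LP($\mathcal{E}$) is infeasible, return "not locally linear feasible at $\bm\zeta_0$" (R1). - Else if it is feasible with $t^\star_{\mathcal{E}}>0$, return "locally linear feasible at $\bm\zeta_0$" (R2). - Else solve Sub-LP($\mathcal{E},i$) for all $i\notin\mathcal{E}$, set $\mathcal{N}=\{i\notin\mathcal{E}:\sigma^\star_{\mathcal{E},i}=b_i\}$, and update $\mathcal{E}\leftarrow\mathcal{E}\cup\mathcal{N}$. After the loop: solve LP($\mathcal{E}$). - If it is infeasible, return "not locally linear feasible at $\bm\zeta_0$" (R3). - Otherwise return "locally linear feasible at $\bm\zeta_0$" (R4). *)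

theory Defs
  imports "HOL-Analysis.Analysis" "HOL-Library.While_Combinator" "HOL-Library.Multiset"
begin

section \<open>Vertices, edges and locally linear feasibility\<close>

definition is_edge_direction ::
  "'a::real_vector \<Rightarrow> 'a set \<Rightarrow> 'a \<Rightarrow> bool" where
  "is_edge_direction \<zeta> e v \<longleftrightarrow>
     v \<noteq> 0 \<and> (\<exists>\<delta>>0. \<forall>t. 0 < t \<and> t < \<delta> \<longrightarrow> \<zeta> + t *\<^sub>R v \<in> e)"

text \<open>The list \<open>vs\<close> contains exactly one direction for each edge of \<open>\<Xi>\<close> incident to \<open>\<zeta>\<close>.
  It is empty if \<open>\<Xi> = {\<zeta>}\<close>.\<close>

definition edge_directions ::
  "'a::euclidean_space set \<Rightarrow> 'a \<Rightarrow> 'a list \<Rightarrow> bool" where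
  "edge_directions \<Xi> \<zeta> vs \<longleftrightarrow>
     (\<exists>es. distinct es \<and> set es = {e. e edge_of \<Xi> \<and> \<zeta> \<in> e} \<and>
           list_all2 (is_edge_direction \<zeta>) es vs)"

text \<open>The order on \<^typ>\<open>real ^ 'm\<close> is the componentwise one.\<close>

definition locally_linear_feasible ::
  "real^'r^'m \<Rightarrow> real^'d^'m \<Rightarrow> real^'m \<Rightarrow> (real^'d) set \<Rightarrow> real^'d \<Rightarrow> bool" where
  "locally_linear_feasible W H b \<Xi> \<zeta> \<longleftrightarrow>
     (\<exists>\<epsilon>>0. \<exists>(y\<^sub>0 :: real^'r) (Y :: real^'d^'r).
        \<forall>\<xi> \<in> \<Xi> \<inter> ball \<zeta> \<epsilon>. W *v (y\<^sub>0 + Y *v \<xi>) + H *v \<xi> \<ge> b)"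

section \<open>Linear programs\<close>

text \<open>A maximisation problem over a Euclidean space \<open>'x\<close>. Constraints form a multiset, so that
  their number is counted with repetitions.\<close>

datatype 'x lp_constraint =
    Equal "'x \<Rightarrow> real" "'x \<Rightarrow> real"
  | Greater_Equal "'x \<Rightarrow> real" "'x \<Rightarrow> real"

primrec satisfies :: "'x \<Rightarrow> 'x lp_constraint \<Rightarrow> bool" where
  "satisfies x (Equal f g) \<longleftrightarrow> f x = g x"
| "satisfies x (Greater_Equal f g) \<longleftrightarrow> f x \<ge> g x"

record 'x max_problem =
  objective :: "'x \<Rightarrow> real"
  constraints :: "'x lp_constraint multiset"

definition affine_functional :: "('x::euclidean_space \<Rightarrow> real) \<Rightarrow> bool" where
  "affine_functional f \<longleftrightarrow> (\<exists>a c. \<forall>x. f x = a \<bullet> x + c)"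

primrec affine_constraint :: "'x::euclidean_space lp_constraint \<Rightarrow> bool" where
  "affine_constraint (Equal f g) \<longleftrightarrow> affine_functional f \<and> affine_functional g"
| "affine_constraint (Greater_Equal f g) \<longleftrightarrow> affine_functional f \<and> affine_functional g"

definition is_linear_program :: "'x::euclidean_space max_problem \<Rightarrow> bool" where
  "is_linear_program P \<longleftrightarrow>
     affine_functional (objective P) \<and> (\<forall>c \<in># constraints P. affine_constraint c)"

definition num_variables :: "'x::euclidean_space max_problem \<Rightarrow> nat" where
  "num_variables P = DIM('x)"

definition num_constraints :: "'x max_problem \<Rightarrow> nat" where
  "num_constraints P = size (constraints P)"

text \<open>The number of entries of the coefficient matrix, extended by a row for the objective
  and a column for the constant terms.\<close>

definition lp_size :: "'x::euclidean_space max_problem \<Rightarrow> nat" where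
  "lp_size P = (num_variables P + 1) * (num_constraints P + 1)"

definition feasible_points :: "'x max_problem \<Rightarrow> 'x set" where
  "feasible_points P = {x. \<forall>c \<in># constraints P. satisfies x c}"

definition lp_feasible :: "'x max_problem \<Rightarrow> bool" where
  "lp_feasible P \<longleftrightarrow> feasible_points P \<noteq> {}"

text \<open>For a feasible and bounded linear program the supremum is attained, so that this is the
  maximum; for a feasible and unbounded one it is \<open>\<infinity>\<close>.\<close>

definition optimal_value :: "'x max_problem \<Rightarrow> ereal" where
  "optimal_value P = (SUP x \<in> feasible_points P. ereal (objective P x))"

section \<open>The algorithm\<close>

text \<open>\<open>R1\<close> and \<open>R3\<close> return ``not locally linear feasible'', \<open>R2\<close> and \<open>R4\<close> return
  ``locally linear feasible''.\<close>

datatype return_statement = R1 | R2 | R3 | R4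

primrec says_feasible :: "return_statement \<Rightarrow> bool" where
  "says_feasible R1 = False"
| "says_feasible R2 = True"
| "says_feasible R3 = False"
| "says_feasible R4 = True"

type_synonym ('r, 'd) affine_rule = "(real^'d^'r) \<times> (real^'r)"

text \<open>The fields \<open>iterations\<close> and \<open>solved\<close> do not influence the run: they record the number of
  executions of the loop body and the linear programs solved so far, the left summands being
  over \<open>((Y, y), t)\<close> and the right ones over \<open>(Y, y)\<close>.\<close>

record ('m, 'r, 'd) state =
  active :: "'m set"
  returned :: "return_statement option"
  iterations :: nat
  solved :: "((('r, 'd) affine_rule \<times> real) max_problem + ('r, 'd) affine_rule max_problem) multiset"

locale recourse =
  fixes W :: "real^'r^'m"
    and H :: "real^'d^'m"
    and b :: "real^'m"
    and \<zeta> :: "real^'d"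
    and vs :: "(real^'d) list"
begin

definition R :: "'m \<Rightarrow> ('r, 'd) affine_rule \<Rightarrow> real" where
  "R i = (\<lambda>(Y, y). W $ i \<bullet> (Y *v \<zeta> + y) + H $ i \<bullet> \<zeta>)"

definition D :: "'m \<Rightarrow> nat \<Rightarrow> ('r, 'd) affine_rule \<Rightarrow> real" where
  "D i l = (\<lambda>(Y, y). W $ i \<bullet> (Y *v (vs ! l)) + H $ i \<bullet> (vs ! l))"

definition LP :: "'m set \<Rightarrow> (('r, 'd) affine_rule \<times> real) max_problem" where
  "LP E =
    \<lparr> objective = (\<lambda>(x, t). t),
      constraints =
          {# Equal (\<lambda>(x, t). R i x) (\<lambda>(x, t). b $ i). i \<in># mset_set E #}
        + {# Greater_Equal (\<lambda>(x, t). D i l x) (\<lambda>(x, t). 0).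
               (i, l) \<in># mset_set (E \<times> {..<length vs}) #}
        + {# Greater_Equal (\<lambda>(x, t). R i x) (\<lambda>(x, t). b $ i + t). i \<in># mset_set (- E) #}
        + {# Greater_Equal (\<lambda>(x, t). t) (\<lambda>(x, t). 0) #} \<rparr>"

text \<open>The feasible points of \<open>Sub_LP E i\<close> form the set \<open>\<G>(E)\<close>.\<close>

definition Sub_LP :: "'m set \<Rightarrow> 'm \<Rightarrow> ('r, 'd) affine_rule max_problem" where
  "Sub_LP E i =
    \<lparr> objective = R i,
      constraints =
          {# Equal (R j) (\<lambda>x. b $ j). j \<in># mset_set E #}
        + {# Greater_Equal (D j l) (\<lambda>x. 0). (j, l) \<in># mset_set (E \<times> {..<length vs}) #}
        + {# Greater_Equal (R j) (\<lambda>x. b $ j). j \<in># mset_set (- E) #} \<rparr>"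

definition initial :: "('m, 'r, 'd) state" where
  "initial = \<lparr> active = {}, returned = None, iterations = 0, solved = {#} \<rparr>"

definition loop_body :: "('m, 'r, 'd) state \<Rightarrow> ('m, 'r, 'd) state" where
  "loop_body s =
    (let E = active s;
         s' = s\<lparr> iterations := iterations s + 1, solved := solved s + {# Inl (LP E) #} \<rparr>
     in if \<not> lp_feasible (LP E) then s'\<lparr> returned := Some R1 \<rparr>
        else if optimal_value (LP E) > 0 then s'\<lparr> returned := Some R2 \<rparr>
        else let N = {i. i \<notin> E \<and> optimal_value (Sub_LP E i) = ereal (b $ i)}
             in s'\<lparr> active := E \<union> N,
                    solved := solved s' + {# Inr (Sub_LP E i). i \<in># mset_set (- E) #} \<rparr>)"

definition loop :: "('m, 'r, 'd) state option" where
  "loop = while_option (\<lambda>s. returned s = None \<and> card (active s) < CARD('m)) loop_body initial"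

definition after_loop :: "('m, 'r, 'd) state \<Rightarrow> ('m, 'r, 'd) state" where
  "after_loop s =
    (if returned s \<noteq> None then s
     else s\<lparr> solved := solved s + {# Inl (LP (active s)) #},
             returned := Some (if \<not> lp_feasible (LP (active s)) then R3 else R4) \<rparr>)"

text \<open>The value is \<^const>\<open>None\<close> if the loop does not terminate.\<close>

definition algorithm :: "('m, 'r, 'd) state option" where
  "algorithm = map_option after_loop loop"

definition returns_feasible :: bool where
  "returns_feasible \<longleftrightarrow>
     (\<exists>s r. algorithm = Some s \<and> returned s = Some r \<and> says_feasible r)"

end

definition lp_bounded_by :: "nat \<Rightarrow> nat \<Rightarrow> 'x::euclidean_space max_problem \<Rightarrow> bool" where
  "lp_bounded_by n k P \<longleftrightarrow>
     is_linear_program P \<and> num_variables P \<le> n \<and> num_constraints P \<le> k \<and>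
     lp_size P \<le> (n + 1) * (k + 1)"

end

theory Submission
  imports Defs
begin

text \<open>
  Local linear feasibility is a finite system of conditions in disguise. Call an affine rule
  \<open>x = (Y, y)\<close> a certificate if every row \<open>i\<close> of the recourse system holds at \<open>\<zeta>\<close>, that is
  \<open>R i x \<ge> b $ i\<close>, and every row that is tight there does not decrease along any edge direction,
  that is \<open>D i l x \<ge> 0\<close> for all \<open>l\<close>. A row with slack at \<open>\<zeta>\<close> stays satisfied nearby by continuity,
  and a tight row changes linearly, so only its behaviour on the directions leading from \<open>\<zeta>\<close> into
  \<open>\<Xi>\<close> matters. Since \<open>\<zeta>\<close> is a vertex of a polyhedron, all these directions are nonnegative
  combinations of the edge directions (\<open>edge_directions_generate\<close>), and so the system is locally
  linear feasible iff a certificate exists (\<open>locally_linear_feasible_iff_certificate\<close>).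

  The difficulty in finding a certificate is that which rows are tight depends on the rule. The
  algorithm maintains a set \<open>E\<close> of rows that are tight for \<^emph>\<open>every\<close> certificate; hence all
  certificates are feasible for \<open>LP E\<close> (with \<open>t = 0\<close>), and infeasibility refutes their existence.
  A feasible point with \<open>t > 0\<close> has slack outside \<open>E\<close> and so is a certificate. If neither happens,
  some row outside \<open>E\<close> is tight on the whole polyhedron \<open>\<G> E\<close>: otherwise each row has slack at some
  point of \<open>\<G> E\<close>, and averaging these points gives one with slack in all rows at once, that is a
  positive \<open>t\<close> (\<open>active_set_grows\<close>). So \<open>E\<close> gains at least one row in each iteration that does not
  return, and all rows it gains are tight for every certificate. When \<open>E\<close> contains all rows, the
  feasible points of \<open>LP E\<close> are certificates.

  An iteration with \<open>n\<close> active rows solves at most \<open>m + 1 - n\<close> programs, and \<open>n\<close> grows strictly, so the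
  loop solves at most \<open>(m + 1) + m + \<dots> + 2\<close> programs; the one after the loop completes this to the
  triangular number \<open>(m + 2) (m + 1) / 2\<close>.
\<close>

section \<open>Feasible directions at a vertex of a polyhedron\<close>

definition feasible_directions :: "'a::real_vector set \<Rightarrow> 'a \<Rightarrow> 'a set" where
  "feasible_directions S z = {v. \<exists>\<epsilon>>0. z + \<epsilon> *\<^sub>R v \<in> S}"

lemma diff_in_feasible_directions:
  assumes "x \<in> S"
  shows "x - z \<in> feasible_directions S z"
  unfolding feasible_directions_def using assms by (auto intro!: exI[of _ 1])

lemma scaleR_in_feasible_directions:
  assumes "v \<in> feasible_directions S z" "0 < k"
  shows "k *\<^sub>R v \<in> feasible_directions S z"
proof -
  obtain \<epsilon> where "\<epsilon> > 0" "z + \<epsilon> *\<^sub>R v \<in> S"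
    using assms by (auto simp: feasible_directions_def)
  then show ?thesis
    unfolding feasible_directions_def using \<open>0 < k\<close> by (auto intro!: exI[of _ "\<epsilon> / k"])
qed

lemma feasible_direction_shrink:
  assumes "convex S" "z \<in> S" "z + \<epsilon> *\<^sub>R v \<in> S" "0 \<le> t" "t \<le> \<epsilon>"
  shows "z + t *\<^sub>R v \<in> S"
proof (cases "\<epsilon> = 0")
  case False
  then have "z + t *\<^sub>R v = (1 - t / \<epsilon>) *\<^sub>R z + (t / \<epsilon>) *\<^sub>R (z + \<epsilon> *\<^sub>R v)"
    by (simp add: algebra_simps)
  also have "\<dots> \<in> S"
    using assms False by (intro convexD_alt) (auto simp: divide_simps)
  finally show ?thesis .
qed (use assms in auto)

text \<open>Only the half-spaces with \<open>z\<close> on their boundary restrict the directions; finitely many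
  half-spaces with \<open>z\<close> in the interior leave room for a common positive step length. In particular
  the cone of feasible directions is closed, which can fail for other closed convex sets.\<close>

lemma polyhedron_feasible_directions:
  assumes "polyhedron S" "z \<in> S"
  obtains A where "finite A" "feasible_directions S z = {v. \<forall>a\<in>A. a \<bullet> v \<le> 0}"
proof -
  obtain \<H> where "finite \<H>" and S: "S = \<Inter>\<H>"
    and "\<forall>h\<in>\<H>. \<exists>a b. a \<noteq> 0 \<and> h = {x. a \<bullet> x \<le> b}"
    using assms(1) by (auto simp: polyhedron_def)
  then obtain a b where h: "\<And>h. h \<in> \<H> \<Longrightarrow> h = {x. a h \<bullet> x \<le> b h}"
    by metis
  have in_S: "x \<in> S \<longleftrightarrow> (\<forall>h\<in>\<H>. a h \<bullet> x \<le> b h)" for x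
    using h S by blast
  define A where "A = a ` {h \<in> \<H>. a h \<bullet> z = b h}"
  have "v \<in> feasible_directions S z \<longleftrightarrow> (\<forall>a\<in>A. a \<bullet> v \<le> 0)" for v
  proof
    assume "v \<in> feasible_directions S z"
    then obtain \<epsilon> where "\<epsilon> > 0" "z + \<epsilon> *\<^sub>R v \<in> S"
      by (auto simp: feasible_directions_def)
    then show "\<forall>a\<in>A. a \<bullet> v \<le> 0"
      by (auto simp: in_S A_def inner_add_right mult_le_0_iff dest!: bspec)
  next
    assume v: "\<forall>a\<in>A. a \<bullet> v \<le> 0"
    have "\<forall>\<^sub>F t in at_right 0. a h \<bullet> (z + t *\<^sub>R v) \<le> b h" if "h \<in> \<H>" for h
    proof (cases "a h \<bullet> z = b h")
      case True
      then have "a h \<bullet> v \<le> 0"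
        using v that by (auto simp: A_def)
      then show ?thesis
        using True eventually_at_right_less[of "0::real"]
        by (auto elim!: eventually_mono simp: inner_add_right mult_le_0_iff)
    next
      case False
      then have "a h \<bullet> (z + 0 *\<^sub>R v) < b h"
        using assms(2) that by (auto simp: in_S less_le)
      moreover have "((\<lambda>t. a h \<bullet> (z + t *\<^sub>R v)) \<longlongrightarrow> a h \<bullet> (z + 0 *\<^sub>R v)) (at_right 0)"
        by (intro tendsto_intros)
      ultimately have "\<forall>\<^sub>F t in at_right 0. a h \<bullet> (z + t *\<^sub>R v) < b h"
        by (rule order_tendstoD(2)[rotated])
      then show ?thesis
        by (rule eventually_mono) simp
    qed
    then have "\<forall>\<^sub>F t in at_right 0. z + t *\<^sub>R v \<in> S"
      unfolding in_S using \<open>finite \<H>\<close> by (simp add: eventually_ball_finite)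
    then have "\<forall>\<^sub>F t in at_right (0::real). 0 < t \<and> z + t *\<^sub>R v \<in> S"
      using eventually_at_right_less[of "0::real"] by eventually_elim simp
    then show "v \<in> feasible_directions S z"
      using eventually_happens[of _ "at_right (0::real)"]
      by (auto simp: feasible_directions_def trivial_limit_at_right_real)
  qed
  moreover have "finite A"
    using \<open>finite \<H>\<close> by (simp add: A_def)
  ultimately show thesis
    by (intro that[of A]) auto
qed

lemma extreme_point_feasible_directions_pointed:
  assumes "convex S" "z extreme_point_of S"
    and "v \<in> feasible_directions S z" "- v \<in> feasible_directions S z"
  shows "v = 0"
proof (rule ccontr)
  assume "v \<noteq> 0"
  have "z \<in> S"
    using assms(2) by (simp add: extreme_point_of_def)
  obtain \<delta> \<epsilon> where "\<delta> > 0" "z + \<delta> *\<^sub>R v \<in> S" "\<epsilon> > 0" "z + \<epsilon> *\<^sub>R - v \<in> S"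
    using assms(3,4) unfolding feasible_directions_def by blast
  define t where "t = min \<delta> \<epsilon>"
  have t: "0 < t" "t \<le> \<delta>" "t \<le> \<epsilon>"
    using \<open>\<delta> > 0\<close> \<open>\<epsilon> > 0\<close> by (auto simp: t_def)
  have "z + t *\<^sub>R v \<in> S" "z + t *\<^sub>R - v \<in> S"
    using feasible_direction_shrink[OF assms(1) \<open>z \<in> S\<close>] t \<open>z + \<delta> *\<^sub>R v \<in> S\<close> \<open>z + \<epsilon> *\<^sub>R - v \<in> S\<close>
    by (meson less_imp_le)+
  moreover have "z \<in> open_segment (z + t *\<^sub>R v) (z + t *\<^sub>R - v)"
  proof -
    have "z = midpoint (z + t *\<^sub>R v) (z + t *\<^sub>R - v)"
      by (simp add: midpoint_def inverse_eq_divide)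
    moreover have "z + t *\<^sub>R v \<noteq> z + t *\<^sub>R - v"
      using t \<open>v \<noteq> 0\<close> by (simp add: eq_neg_iff_add_eq_0 flip: scaleR_2)
    ultimately show ?thesis
      by (metis midpoint_in_open_segment)
  qed
  ultimately show False
    using assms(2) by (auto simp: extreme_point_of_def)
qed

text \<open>A functional of this kind gives the section of the cone at height 1 to which the
  Krein--Milman theorem is applied below. The negative sum of the defining normals works: on the cone
  all its summands are nonnegative, so it vanishes only where all normals do, that is on the lineality
  space.\<close>

lemma pointed_polyhedral_cone_positive_functional:
  fixes A :: "'a::euclidean_space set"
  assumes "finite A" and C: "C = {v. \<forall>a\<in>A. a \<bullet> v \<le> 0}"
    and pointed: "\<And>v. v \<in> C \<Longrightarrow> - v \<in> C \<Longrightarrow> v = 0"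
    and v: "v \<in> C" "v \<noteq> 0"
  shows "0 < - \<Sum>A \<bullet> v"
proof (rule ccontr)
  assume "\<not> ?thesis"
  then have "(\<Sum>a\<in>A. - (a \<bullet> v)) \<le> 0"
    by (simp add: inner_sum_left sum_negf)
  moreover have "0 \<le> (\<Sum>a\<in>A. - (a \<bullet> v))"
    using v by (intro sum_nonneg) (auto simp: C)
  ultimately have "\<forall>a\<in>A. - (a \<bullet> v) = 0"
    using \<open>finite A\<close> v by (subst sum_nonneg_eq_0_iff[symmetric]) (auto simp: C)
  then have "- v \<in> C"
    by (auto simp: C)
  with pointed v show False
    by blast
qed

text \<open>Positivity on the cone implies a bound \<open>c \<bullet> v \<ge> \<mu> * norm v\<close>, where \<open>\<mu> > 0\<close> is the minimum of
  \<open>c\<close> on the unit vectors of the cone.\<close>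

lemma compact_cone_section:
  fixes C :: "'a::euclidean_space set"
  assumes "closed C" and cone: "\<And>k v. 0 < k \<Longrightarrow> v \<in> C \<Longrightarrow> k *\<^sub>R v \<in> C"
    and pos: "\<And>v. v \<in> C \<Longrightarrow> v \<noteq> 0 \<Longrightarrow> 0 < c \<bullet> v"
  shows "compact {v \<in> C. c \<bullet> v = 1}"
proof -
  obtain \<mu> where "\<mu> > 0" and \<mu>: "\<And>v. v \<in> C \<Longrightarrow> norm v = 1 \<Longrightarrow> \<mu> \<le> c \<bullet> v"
  proof (cases "C \<inter> sphere 0 1 = {}")
    case True
    then show thesis
      by (intro that[of 1]) auto
  next
    case False
    have "compact (C \<inter> sphere 0 1)"
      using \<open>closed C\<close> by (simp add: closed_Int_compact)
    moreover have "continuous_on (C \<inter> sphere 0 1) (\<lambda>v. c \<bullet> v)"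
      by (intro continuous_intros)
    ultimately obtain u
      where "u \<in> C \<inter> sphere 0 1" "\<And>v. v \<in> C \<inter> sphere 0 1 \<Longrightarrow> c \<bullet> u \<le> c \<bullet> v"
      using continuous_attains_inf[of "C \<inter> sphere 0 1" "\<lambda>v. c \<bullet> v"] False by blast
    moreover from this have "0 < c \<bullet> u"
      by (intro pos) auto
    ultimately show thesis
      by (intro that[of "c \<bullet> u"]) auto
  qed
  have "norm v \<le> 1 / \<mu>" if "v \<in> C" "c \<bullet> v = 1" for v
  proof -
    have "v \<noteq> 0"
      using that by auto
    then have "\<mu> \<le> c \<bullet> ((1 / norm v) *\<^sub>R v)"
      using that by (intro \<mu> cone) auto
    then show ?thesis
      using that \<open>\<mu> > 0\<close> \<open>v \<noteq> 0\<close> by (simp add: field_simps)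
  qed
  then have "bounded {v \<in> C. c \<bullet> v = 1}"
    by (auto simp: bounded_iff)
  moreover have "closed {v \<in> C. c \<bullet> v = 1}"
    using \<open>closed C\<close> closed_hyperplane[of c 1] closed_Int by (simp add: Collect_conj_eq)
  ultimately show ?thesis
    by (simp add: compact_eq_bounded_closed)
qed

text \<open>Every nonzero vector of the cone is a positive multiple of a point of the compact section, and
  that point is a convex combination of extreme points.\<close>

lemma cone_generated_by_section:
  fixes C :: "'a::euclidean_space set"
  assumes "closed C" "convex C" and cone: "\<And>k v. 0 < k \<Longrightarrow> v \<in> C \<Longrightarrow> k *\<^sub>R v \<in> C"
    and pos: "\<And>v. v \<in> C \<Longrightarrow> v \<noteq> 0 \<Longrightarrow> 0 < c \<bullet> v"
  shows "C \<subseteq> convex_cone hull {w. w extreme_point_of {v \<in> C. c \<bullet> v = 1}}"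
proof
  fix v assume "v \<in> C"
  let ?B = "{v \<in> C. c \<bullet> v = 1}"
  let ?E = "{w. w extreme_point_of ?B}"
  show "v \<in> convex_cone hull ?E"
  proof (cases "v = 0")
    case True
    then show ?thesis
      by (simp add: convex_cone_hull_contains_0)
  next
    case False
    then have "0 < c \<bullet> v"
      using pos \<open>v \<in> C\<close> by blast
    have "compact ?B"
      using assms(1) cone pos by (rule compact_cone_section)
    moreover have "convex ?B"
      using \<open>convex C\<close> convex_hyperplane[of c 1] convex_Int by (simp add: Collect_conj_eq)
    moreover have "(1 / (c \<bullet> v)) *\<^sub>R v \<in> ?B"
      using cone \<open>v \<in> C\<close> \<open>0 < c \<bullet> v\<close> by simp
    ultimately have "(1 / (c \<bullet> v)) *\<^sub>R v \<in> convex hull ?E"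
      using Krein_Milman_Minkowski by blast
    also have "convex hull ?E \<subseteq> convex_cone hull ?E"
      by (simp add: hull_minimal hull_subset convex_convex_cone_hull)
    finally have "(c \<bullet> v) *\<^sub>R ((1 / (c \<bullet> v)) *\<^sub>R v) \<in> convex_cone hull ?E"
      using \<open>0 < c \<bullet> v\<close> by (simp only: convex_cone_hull_mul)
    then show ?thesis
      using \<open>0 < c \<bullet> v\<close> by simp
  qed
qed

text \<open>This identifies the extreme points of the section with edges of the set itself: the face
  property of the ray follows from the extremality of its direction.\<close>

lemma extreme_section_point_spans_edge:
  fixes S :: "'a::euclidean_space set"
  assumes "convex S" "z \<in> S"
    and pos: "\<And>v. v \<in> feasible_directions S z \<Longrightarrow> v \<noteq> 0 \<Longrightarrow> 0 < c \<bullet> v"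
    and w: "w extreme_point_of {v \<in> feasible_directions S z. c \<bullet> v = 1}"
  shows "S \<inter> {z + t *\<^sub>R w |t. 0 \<le> t} edge_of S"
proof -
  let ?C = "feasible_directions S z"
  let ?F = "S \<inter> {z + t *\<^sub>R w |t. 0 \<le> t}"
  have "w \<in> ?C" "c \<bullet> w = 1" "w \<noteq> 0"
    using w by (auto simp: extreme_point_of_def)
  \<comment> \<open>Normalise the summands to height 1: this turns them into end points of a segment of the
    section with \<open>w\<close> in its interior, unless one of them vanishes.\<close>
  have ray: "\<exists>s\<ge>0. p = s *\<^sub>R w"
    if "p \<in> ?C" "q \<in> ?C" "0 < u" "u < 1" "(1 - u) *\<^sub>R p + u *\<^sub>R q = t *\<^sub>R w" "0 \<le> t" for p q u t
  proof -
    consider "p = 0" | "q = 0" | "p \<noteq> 0" "q \<noteq> 0"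
      by blast
    then show ?thesis
    proof cases
      case 1
      then show ?thesis
        by (intro exI[of _ 0]) simp
    next
      case 2
      have "p = (1 / (1 - u)) *\<^sub>R ((1 - u) *\<^sub>R p)"
        using that by simp
      also have "\<dots> = (t / (1 - u)) *\<^sub>R w"
        using that 2 by simp
      finally show ?thesis
        using that by (intro exI[of _ "t / (1 - u)"]) auto
    next
      case 3
      define \<alpha> \<beta> where "\<alpha> = c \<bullet> p" and "\<beta> = c \<bullet> q"
      have "\<alpha> > 0" "\<beta> > 0"
        using 3 pos that by (auto simp: \<alpha>_def \<beta>_def)
      have t: "t = (1 - u) * \<alpha> + u * \<beta>"
        using arg_cong[OF that(5), of "\<lambda>x. c \<bullet> x"] \<open>c \<bullet> w = 1\<close>
        by (simp add: \<alpha>_def \<beta>_def inner_add_right)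
      have "0 < t"
        unfolding t using that \<open>\<alpha> > 0\<close> \<open>\<beta> > 0\<close> by (simp add: add_pos_pos)
      let ?p = "(1 / \<alpha>) *\<^sub>R p" and ?q = "(1 / \<beta>) *\<^sub>R q"
      have in_section: "?p \<in> {v \<in> ?C. c \<bullet> v = 1}" "?q \<in> {v \<in> ?C. c \<bullet> v = 1}"
        using \<open>\<alpha> > 0\<close> \<open>\<beta> > 0\<close> that
        by (auto simp: \<alpha>_def \<beta>_def intro!: scaleR_in_feasible_directions)
      define s where "s = u * \<beta> / t"
      have "1 - s = (1 - u) * \<alpha> / t"
        using \<open>0 < t\<close> by (simp add: s_def t field_simps)
      have "w = (1 / t) *\<^sub>R (t *\<^sub>R w)"
        using \<open>0 < t\<close> by simp
      also have "\<dots> = (1 / t) *\<^sub>R ((1 - u) *\<^sub>R p + u *\<^sub>R q)"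
        using that(5) by simp
      also have "\<dots> = (1 - s) *\<^sub>R ?p + s *\<^sub>R ?q"
        unfolding \<open>1 - s = _\<close> using \<open>\<alpha> > 0\<close> \<open>\<beta> > 0\<close> by (simp add: s_def scaleR_add_right)
      finally have w_eq: "w = (1 - s) *\<^sub>R ?p + s *\<^sub>R ?q" .
      have "0 < s"
        using \<open>0 < t\<close> \<open>\<beta> > 0\<close> that by (simp add: s_def)
      have "s < 1"
      proof -
        have "0 < 1 - s"
          unfolding \<open>1 - s = _\<close> using \<open>0 < t\<close> \<open>\<alpha> > 0\<close> that by simp
        then show ?thesis
          by simp
      qed
      have "?p = ?q"
        using w in_section w_eq \<open>0 < s\<close> \<open>s < 1\<close>
        unfolding extreme_point_of_def in_segment by blast
      then have "w = ?p"
        using w_eq unfolding \<open>?p = ?q\<close>[symmetric] scaleR_add_left[symmetric] by simp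
      then have "p = \<alpha> *\<^sub>R w"
        using \<open>\<alpha> > 0\<close> by simp
      then show ?thesis
        using \<open>\<alpha> > 0\<close> by (intro exI[of _ \<alpha>]) auto
    qed
  qed
  have half: "x \<in> ?F" if S: "x \<in> S" "y \<in> S" and p_in: "p \<in> ?F" "p \<in> open_segment x y" for x y p
  proof -
    obtain u where "0 < u" "u < 1" and p: "p = (1 - u) *\<^sub>R x + u *\<^sub>R y"
      using p_in(2) by (auto simp: in_segment)
    obtain t where "0 \<le> t" "p = z + t *\<^sub>R w"
      using p_in(1) by auto
    then have "(1 - u) *\<^sub>R (x - z) + u *\<^sub>R (y - z) = t *\<^sub>R w"
      using p by (simp add: algebra_simps)
    then obtain s where "0 \<le> s" "x - z = s *\<^sub>R w"
      using ray[OF diff_in_feasible_directions[OF S(1)] diff_in_feasible_directions[OF S(2)]]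
        \<open>0 < u\<close> \<open>u < 1\<close> \<open>0 \<le> t\<close> by blast
    then show ?thesis
      using S(1) by (auto simp: algebra_simps intro!: exI[of _ s])
  qed
  have "convex {z + t *\<^sub>R w |t. 0 \<le> t}"
  proof -
    have "{z + t *\<^sub>R w |t. 0 \<le> t} = (+) z ` (\<lambda>t. t *\<^sub>R w) ` {0..}"
      by auto
    then show ?thesis
      by (simp add: convex_translation convex_linear_image linear_scaleR_left)
  qed
  then have "convex ?F"
    using \<open>convex S\<close> by (rule convex_Int[rotated])
  moreover have "x \<in> ?F \<and> y \<in> ?F" if "x \<in> S" "y \<in> S" "p \<in> ?F" "p \<in> open_segment x y" for x y p
    using half[of x y p] half[of y x p] that by (simp add: open_segment_commute)
  ultimately have "?F face_of S"
    unfolding face_of_def by blast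
  moreover have "aff_dim ?F = 1"
  proof (rule antisym)
    have "collinear ?F"
      unfolding collinear_def
      by (intro exI[of _ w]) (auto simp flip: scaleR_left_diff_distrib)
    then show "aff_dim ?F \<le> 1"
      by (simp add: collinear_aff_dim)
    obtain \<epsilon> where "\<epsilon> > 0" "z + \<epsilon> *\<^sub>R w \<in> S"
      using \<open>w \<in> ?C\<close> by (auto simp: feasible_directions_def)
    then have "z + \<epsilon> *\<^sub>R w \<in> ?F"
      by (auto intro!: exI[of _ \<epsilon>])
    moreover have "z \<in> ?F"
      using \<open>z \<in> S\<close> by (auto intro!: exI[of _ 0])
    ultimately have "{z, z + \<epsilon> *\<^sub>R w} \<subseteq> ?F"
      by blast
    then have "aff_dim {z, z + \<epsilon> *\<^sub>R w} \<le> aff_dim ?F"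
      by (rule aff_dim_subset)
    then show "1 \<le> aff_dim ?F"
      using \<open>\<epsilon> > 0\<close> \<open>w \<noteq> 0\<close> by (simp add: aff_dim_2)
  qed
  ultimately show ?thesis
    by (simp add: edge_of_def)
qed

lemma edge_directions_complete:
  assumes "edge_directions \<Xi> \<zeta> vs" "e edge_of \<Xi>" "\<zeta> \<in> e"
  obtains v where "v \<in> set vs" "is_edge_direction \<zeta> e v"
proof -
  obtain es where "set es = {e. e edge_of \<Xi> \<and> \<zeta> \<in> e}"
    and dirs: "list_all2 (is_edge_direction \<zeta>) es vs"
    using assms(1) by (auto simp: edge_directions_def)
  then have "e \<in> set es"
    using assms(2,3) by simp
  then obtain n where "n < length es" "es ! n = e"
    by (auto simp: in_set_conv_nth)
  then show thesis
    using dirs by (intro that[of "vs ! n"]) (auto simp: list_all2_conv_all_nth)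
qed

lemma edge_directions_sound:
  assumes "edge_directions \<Xi> \<zeta> vs" "v \<in> set vs"
  shows "v \<in> feasible_directions \<Xi> \<zeta>"
proof -
  obtain es where es: "set es = {e. e edge_of \<Xi> \<and> \<zeta> \<in> e}"
    and dirs: "list_all2 (is_edge_direction \<zeta>) es vs"
    using assms(1) by (auto simp: edge_directions_def)
  obtain n where "n < length vs" "vs ! n = v"
    using assms(2) by (auto simp: in_set_conv_nth)
  then have "es ! n \<in> set es" "is_edge_direction \<zeta> (es ! n) v"
    using dirs by (auto simp: list_all2_conv_all_nth)
  moreover from this(2) obtain \<delta> where \<delta>: "\<delta> > 0"
    and "\<And>t. 0 < t \<Longrightarrow> t < \<delta> \<Longrightarrow> \<zeta> + t *\<^sub>R v \<in> es ! n"
    unfolding is_edge_direction_def by blast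
  then have "\<zeta> + (\<delta> / 2) *\<^sub>R v \<in> es ! n"
    by simp
  ultimately show ?thesis
    unfolding feasible_directions_def using \<delta>(1) es edge_of_imp_subset[of "es ! n" \<Xi>]
    by (auto intro!: exI[of _ "\<delta> / 2"])
qed

text \<open>The set lies in the cone with apex \<open>\<zeta>\<close> generated by its edge directions. The convex cone hull
  contains 0 by definition, which covers the case \<open>\<Xi> = {\<zeta>}\<close> without edges.\<close>

lemma edge_directions_generate:
  assumes "polyhedron \<Xi>" "\<zeta> extreme_point_of \<Xi>" "edge_directions \<Xi> \<zeta> vs" "\<xi> \<in> \<Xi>"
  shows "\<xi> - \<zeta> \<in> convex_cone hull (set vs)"
proof -
  let ?C = "feasible_directions \<Xi> \<zeta>"
  have "convex \<Xi>" "\<zeta> \<in> \<Xi>"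
    using assms by (auto simp: polyhedron_imp_convex extreme_point_of_def)
  obtain A where "finite A" and C: "?C = {v. \<forall>a\<in>A. a \<bullet> v \<le> 0}"
    using polyhedron_feasible_directions[OF assms(1) \<open>\<zeta> \<in> \<Xi>\<close>] .
  have C': "?C = (\<Inter>a\<in>A. {v. a \<bullet> v \<le> 0})"
    by (auto simp: C)
  define c where "c = - \<Sum>A"
  have pos: "0 < c \<bullet> v" if "v \<in> ?C" "v \<noteq> 0" for v
    unfolding c_def using \<open>finite A\<close> C _ that
    by (rule pointed_polyhedral_cone_positive_functional)
      (rule extreme_point_feasible_directions_pointed[OF \<open>convex \<Xi>\<close> assms(2)])
  let ?E = "{w. w extreme_point_of {v \<in> ?C. c \<bullet> v = 1}}"
  have "\<xi> - \<zeta> \<in> ?C"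
    using assms(4) by (rule diff_in_feasible_directions)
  also have "?C \<subseteq> convex_cone hull ?E"
  proof (rule cone_generated_by_section)
    show "closed ?C"
      unfolding C' by (intro closed_INT ballI closed_halfspace_le)
    show "convex ?C"
      unfolding C' by (intro convex_INT convex_halfspace_le)
  qed (auto intro: scaleR_in_feasible_directions pos)
  also have "\<dots> \<subseteq> convex_cone hull (set vs)"
  proof (rule hull_minimal[where S = convex_cone])
    show "?E \<subseteq> convex_cone hull (set vs)"
    proof
      fix w assume w: "w \<in> ?E"
      then have "c \<bullet> w = 1"
        by (simp add: extreme_point_of_def)
      let ?e = "\<Xi> \<inter> {\<zeta> + t *\<^sub>R w |t. 0 \<le> t}"
      have "?e edge_of \<Xi>"
        using extreme_section_point_spans_edge[OF \<open>convex \<Xi>\<close> \<open>\<zeta> \<in> \<Xi>\<close> pos] w by blast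
      moreover have "\<zeta> \<in> ?e"
        using \<open>\<zeta> \<in> \<Xi>\<close> by (auto intro!: exI[of _ 0])
      ultimately obtain v where "v \<in> set vs" and v: "is_edge_direction \<zeta> ?e v"
        using edge_directions_complete[OF assms(3)] by blast
      obtain \<delta> where "v \<noteq> 0" "\<delta> > 0" "\<And>t. 0 < t \<Longrightarrow> t < \<delta> \<Longrightarrow> \<zeta> + t *\<^sub>R v \<in> ?e"
        using v unfolding is_edge_direction_def by blast
      then have "\<zeta> + (\<delta> / 2) *\<^sub>R v \<in> ?e"
        by simp
      then obtain t where t: "(\<delta> / 2) *\<^sub>R v = t *\<^sub>R w" "0 \<le> t"
        by auto
      moreover have "t \<noteq> 0"
        using t(1) \<open>v \<noteq> 0\<close> \<open>\<delta> > 0\<close> by auto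
      ultimately have "w = (1 / t) *\<^sub>R (\<delta> / 2) *\<^sub>R v"
        by simp
      also have "\<dots> \<in> convex_cone hull (set vs)"
        using \<open>v \<in> set vs\<close> \<open>0 \<le> t\<close> \<open>\<delta> > 0\<close> by (intro convex_cone_hull_mul hull_inc) auto
      finally show "w \<in> convex_cone hull (set vs)" .
    qed
  qed (rule convex_cone_convex_cone_hull)
  finally show ?thesis .
qed

section \<open>Affine functionals and sizes of linear programs\<close>

lemma affine_functional_linear:
  fixes f :: "'a::euclidean_space \<Rightarrow> real"
  assumes "linear f"
  shows "affine_functional (\<lambda>x. f x + c)"
  unfolding affine_functional_def
  using adjoint_works[OF assms, of _ 1] by (intro exI[of _ "adjoint f 1"] exI[of _ c]) (simp add: inner_commute)

lemma affine_functional_const [simp]: "affine_functional (\<lambda>x. c)"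
  unfolding affine_functional_def by (intro exI[of _ 0] exI[of _ c]) auto

lemma affine_functional_fst:
  assumes "affine_functional f"
  shows "affine_functional (\<lambda>(x, t::real). f x)"
proof -
  obtain a c where "\<And>x. f x = a \<bullet> x + c"
    using assms by (auto simp: affine_functional_def)
  then show ?thesis
    unfolding affine_functional_def by (intro exI[of _ "(a, 0)"] exI[of _ c]) (auto simp: inner_Pair)
qed

lemma affine_functional_snd:
  "affine_functional (\<lambda>(x::'a::euclidean_space, t::real). c + t)"
  unfolding affine_functional_def by (intro exI[of _ "(0, 1)"] exI[of _ c]) (auto simp: inner_Pair)

lemma affine_functional_midpoint:
  assumes "affine_functional f"
  shows "f (midpoint x y) = (f x + f y) / 2"
proof -
  obtain a c where "\<And>x. f x = a \<bullet> x + c"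
    using assms by (auto simp: affine_functional_def)
  then show ?thesis
    by (simp add: midpoint_def inner_add_right field_simps)
qed

lemma lp_bounded_byI:
  assumes "is_linear_program P" "num_variables P \<le> n" "num_constraints P \<le> k"
  shows "lp_bounded_by n k P"
  unfolding lp_bounded_by_def lp_size_def using assms by (intro conjI mult_le_mono) auto

text \<open>A bound for the number of programs solved on \<open>m\<close> rows until \<open>n\<close> of them are active.\<close>

definition lp_budget :: "nat \<Rightarrow> nat \<Rightarrow> nat" where
  "lp_budget m n = (\<Sum>j<n. m + 1 - j)"

lemma lp_budget_mono: "n \<le> n' \<Longrightarrow> lp_budget m n \<le> lp_budget m n'"
  unfolding lp_budget_def by (intro sum_mono2) auto

text \<open>The summand \<open>m + 1 - n\<close> pays for one iteration with \<open>n\<close> active rows: one program for the set of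
  active rows and one for each of the \<open>m - n\<close> remaining rows.\<close>

lemma lp_budget_step:
  assumes "n < n'"
  shows "lp_budget m n + (m + 1 - n) \<le> lp_budget m n'"
  using lp_budget_mono[of "Suc n" n' m] assms by (simp add: lp_budget_def)

text \<open>The product on the left is twice the sum \<open>1 + 2 + \<dots> + (m + 1 - n)\<close> of the remaining summands.
  This form makes the induction free of truncated divisions.\<close>

lemma lp_budget_closed_form:
  "n \<le> m + 1 \<Longrightarrow> 2 * lp_budget m n + (m + 1 - n) * (m + 2 - n) = (m + 2) * (m + 1)"
proof (induction n)
  case 0
  then show ?case
    by (simp add: lp_budget_def)
next
  case (Suc n)
  then obtain k where k: "m = n + k"
    using le_Suc_ex[of n m] by auto
  show ?case
    using Suc.IH Suc.prems by (simp add: lp_budget_def k algebra_simps)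
qed

lemma lp_budget_total: "lp_budget m m + 1 = (m + 2) * (m + 1) div 2"
  using lp_budget_closed_form[of m m] by simp

lemma card_Compl: "card (- A) = CARD('a) - card A" for A :: "'a::finite set"
  by (simp add: Compl_eq_Diff_UNIV card_Diff_subset)

context recourse
begin

section \<open>Certificates and the linear programs\<close>

lemma affine_R: "affine_functional (R i)"
proof -
  have "linear (\<lambda>x. W $ i \<bullet> (fst x *v \<zeta> + snd x))"
    by (intro linearI)
      (auto simp: matrix_vector_mult_add_rdistrib inner_add_right distrib_left
        simp flip: scaleR_matrix_vector_assoc)
  from affine_functional_linear[OF this, of "H $ i \<bullet> \<zeta>"] show ?thesis
    by (simp add: R_def case_prod_unfold)
qed

lemma affine_D: "affine_functional (D i l)"
proof -
  have "linear (\<lambda>x :: (real^'d^'r) \<times> (real^'r). W $ i \<bullet> (fst x *v (vs ! l)))"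
    by (intro linearI)
      (auto simp: matrix_vector_mult_add_rdistrib inner_add_right
        simp flip: scaleR_matrix_vector_assoc)
  from affine_functional_linear[OF this, of "H $ i \<bullet> (vs ! l)"] show ?thesis
    by (simp add: D_def case_prod_unfold)
qed

lemma lp_bounded_LP:
  "lp_bounded_by (CARD('r) * CARD('d) + CARD('r) + 1) (CARD('m) * length vs + CARD('m) + 1) (LP E)"
proof (rule lp_bounded_byI)
  have "affine_functional (\<lambda>(x :: (real^'d^'r) \<times> (real^'r), t::real). t)"
    using affine_functional_snd[of 0] by simp
  moreover have "affine_functional (\<lambda>(x :: (real^'d^'r) \<times> (real^'r), t::real). c)" for c
    by (simp add: case_prod_unfold)
  ultimately show "is_linear_program (LP E)"
    by (auto simp: is_linear_program_def LP_def affine_functional_snd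
        intro!: affine_functional_fst affine_R affine_D)
  show "num_variables (LP E) \<le> CARD('r) * CARD('d) + CARD('r) + 1"
    by (simp add: num_variables_def)
  have "card E + card (- E) = CARD('m)"
    by (simp add: card_Compl card_mono)
  moreover have "num_constraints (LP E) = card E + card E * length vs + card (- E) + 1"
    by (simp add: num_constraints_def LP_def card_cartesian_product)
  moreover have "card E * length vs \<le> CARD('m) * length vs"
    by (simp add: card_mono)
  ultimately show "num_constraints (LP E) \<le> CARD('m) * length vs + CARD('m) + 1"
    by linarith
qed

lemma lp_bounded_Sub_LP:
  "lp_bounded_by (CARD('r) * CARD('d) + CARD('r) + 1) (CARD('m) * length vs + CARD('m) + 1)
     (Sub_LP E i)"
proof (rule lp_bounded_byI)
  show "is_linear_program (Sub_LP E i)"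
    by (auto simp: is_linear_program_def Sub_LP_def affine_R affine_D)
  show "num_variables (Sub_LP E i) \<le> CARD('r) * CARD('d) + CARD('r) + 1"
    by (simp add: num_variables_def)
  have "card E + card (- E) = CARD('m)"
    by (simp add: card_Compl card_mono)
  moreover have "num_constraints (Sub_LP E i) = card E + card E * length vs + card (- E)"
    by (simp add: num_constraints_def Sub_LP_def card_cartesian_product)
  moreover have "card E * length vs \<le> CARD('m) * length vs"
    by (simp add: card_mono)
  ultimately show "num_constraints (Sub_LP E i) \<le> CARD('m) * length vs + CARD('m) + 1"
    by linarith
qed

text \<open>The guard of the derivative conditions by tightness means that the set of certificates is in
  general not closed, so that it is not the feasible region of a single linear program.\<close>

definition certificate :: "('r, 'd) affine_rule \<Rightarrow> bool" where
  "certificate x \<longleftrightarrow>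
     (\<forall>i. b $ i \<le> R i x \<and> (R i x = b $ i \<longrightarrow> (\<forall>l<length vs. 0 \<le> D i l x)))"

text \<open>The feasible points of the sub-programs, as a set that is independent of the objective.\<close>

definition \<G> :: "'m set \<Rightarrow> ('r, 'd) affine_rule set" where
  "\<G> E = {x. (\<forall>i\<in>E. R i x = b $ i \<and> (\<forall>l<length vs. 0 \<le> D i l x)) \<and> (\<forall>i\<in>- E. b $ i \<le> R i x)}"

lemma feasible_points_Sub_LP: "feasible_points (Sub_LP E i) = \<G> E"
proof (rule set_eqI)
  fix x
  have "x \<in> feasible_points (Sub_LP E i) \<longleftrightarrow>
      (\<forall>j\<in>E. R j x = b $ j) \<and> (\<forall>j\<in>E. \<forall>l\<in>{..<length vs}. 0 \<le> D j l x) \<and> (\<forall>j\<in>- E. b $ j \<le> R j x)"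
    by (simp add: feasible_points_def Sub_LP_def ball_Un split_paired_Ball_Sigma conj_assoc)
  then show "x \<in> feasible_points (Sub_LP E i) \<longleftrightarrow> x \<in> \<G> E"
    by (auto simp: \<G>_def)
qed

lemma feasible_points_LP:
  "(x, t) \<in> feasible_points (LP E) \<longleftrightarrow> x \<in> \<G> E \<and> 0 \<le> t \<and> (\<forall>i\<in>- E. b $ i + t \<le> R i x)"
proof -
  have "(x, t) \<in> feasible_points (LP E) \<longleftrightarrow>
      (\<forall>i\<in>E. R i x = b $ i) \<and> (\<forall>i\<in>E. \<forall>l\<in>{..<length vs}. 0 \<le> D i l x) \<and>
      (\<forall>i\<in>- E. b $ i + t \<le> R i x) \<and> 0 \<le> t"
    by (auto simp add: feasible_points_def LP_def ball_Un split_paired_Ball_Sigma)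
  moreover have "\<forall>i\<in>- E. b $ i \<le> R i x" if "0 \<le> t" "\<forall>i\<in>- E. b $ i + t \<le> R i x"
  proof
    fix i assume "i \<in> - E"
    then have "b $ i + t \<le> R i x"
      using that(2) by blast
    then show "b $ i \<le> R i x"
      using that(1) by simp
  qed
  ultimately show ?thesis
    by (auto simp: \<G>_def)
qed

lemma lp_feasible_LP: "lp_feasible (LP E) \<longleftrightarrow> \<G> E \<noteq> {}"
proof
  assume "lp_feasible (LP E)"
  then show "\<G> E \<noteq> {}"
    unfolding lp_feasible_def using feasible_points_LP by fastforce
next
  assume "\<G> E \<noteq> {}"
  then obtain x where "x \<in> \<G> E"
    by blast
  then have "(x, 0) \<in> feasible_points (LP E)"
    by (auto simp: feasible_points_LP \<G>_def)
  then show "lp_feasible (LP E)"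
    by (auto simp: lp_feasible_def)
qed

lemma optimal_value_LP_pos:
  "0 < optimal_value (LP E) \<longleftrightarrow> (\<exists>x t. (x, t) \<in> feasible_points (LP E) \<and> 0 < t)"
  unfolding optimal_value_def less_SUP_iff by (auto simp: LP_def Bex_def)

lemma midpoint_in_\<G>:
  assumes "x \<in> \<G> E" "y \<in> \<G> E"
  shows "midpoint x y \<in> \<G> E"
proof -
  have "b $ i \<le> R i (midpoint x y)" if "i \<in> - E" for i
  proof -
    have "b $ i \<le> R i x" "b $ i \<le> R i y"
      using assms that by (auto simp: \<G>_def)
    then show ?thesis
      by (simp add: affine_functional_midpoint[OF affine_R])
  qed
  then show ?thesis
    using assms
    by (auto simp: \<G>_def affine_functional_midpoint[OF affine_R] affine_functional_midpoint[OF affine_D])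
qed

text \<open>Midpoints keep every strict inequality of either end point, since the other end point satisfies
  the weak one.\<close>

lemma slack_simultaneously:
  assumes "finite I" "\<G> E \<noteq> {}" "I \<subseteq> - E"
    and "\<And>i. i \<in> I \<Longrightarrow> \<exists>x\<in>\<G> E. b $ i < R i x"
  shows "\<exists>x\<in>\<G> E. \<forall>i\<in>I. b $ i < R i x"
  using assms(1,3,4)
proof (induction I rule: finite_induct)
  case empty
  then show ?case
    using \<open>\<G> E \<noteq> {}\<close> by auto
next
  case (insert j I)
  then obtain x where x: "x \<in> \<G> E" "\<forall>i\<in>I. b $ i < R i x"
    by auto
  obtain y where y: "y \<in> \<G> E" "b $ j < R j y"
    using insert.prems(2)[of j] by blast
  have "b $ i < R i (midpoint x y)" if "i \<in> insert j I" for i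
  proof -
    have "b $ i \<le> R i x" "b $ i \<le> R i y" "b $ i < R i x \<or> b $ i < R i y"
      using x y that insert.prems(1) by (auto simp: \<G>_def)
    then show ?thesis
      by (auto simp: affine_functional_midpoint[OF affine_R])
  qed
  then show ?case
    using midpoint_in_\<G> x y by blast
qed

text \<open>The progress argument. If no further row is forced to be tight on \<open>\<G> E\<close>, then one point of \<open>\<G> E\<close>
  has slack in all rows outside \<open>E\<close>, and the least of these slacks is a positive value of \<open>t\<close>.\<close>

lemma active_set_grows:
  assumes "lp_feasible (LP E)" "\<not> 0 < optimal_value (LP E)" "E \<noteq> UNIV"
  shows "\<exists>i. i \<notin> E \<and> optimal_value (Sub_LP E i) = ereal (b $ i)"
proof (rule ccontr)
  assume none: "\<not> ?thesis"
  have "\<G> E \<noteq> {}"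
    using assms(1) by (simp add: lp_feasible_LP)
  have "\<exists>x\<in>\<G> E. b $ i < R i x" if "i \<in> - E" for i
  proof (rule ccontr)
    assume no_slack: "\<not> ?thesis"
    have tight: "R i x = b $ i" if x: "x \<in> \<G> E" for x
    proof (rule antisym)
      show "R i x \<le> b $ i"
        using no_slack x by (meson not_le)
      show "b $ i \<le> R i x"
        using x \<open>i \<in> - E\<close> by (simp add: \<G>_def)
    qed
    have "optimal_value (Sub_LP E i) = (SUP x\<in>\<G> E. ereal (b $ i))"
      unfolding optimal_value_def feasible_points_Sub_LP
      by (intro SUP_cong) (auto simp: Sub_LP_def tight)
    then show False
      using none \<open>i \<in> - E\<close> \<open>\<G> E \<noteq> {}\<close> by auto
  qed
  then obtain x where x: "x \<in> \<G> E" "\<forall>i\<in>- E. b $ i < R i x"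
    using slack_simultaneously[of "- E" E] \<open>\<G> E \<noteq> {}\<close> by auto
  define t where "t = Min ((\<lambda>i. R i x - b $ i) ` (- E))"
  have "- E \<noteq> {}"
    using assms(3) by auto
  then have "0 < t"
    unfolding t_def using x(2) by (subst Min_gr_iff) auto
  have "b $ i + t \<le> R i x" if "i \<in> - E" for i
  proof -
    have "t \<le> R i x - b $ i"
      unfolding t_def using that by (intro Min_le) auto
    then show ?thesis
      by simp
  qed
  then have "(x, t) \<in> feasible_points (LP E)"
    using x(1) \<open>0 < t\<close> by (simp add: feasible_points_LP)
  then show False
    using assms(2) \<open>0 < t\<close> optimal_value_LP_pos by blast
qed

lemma certificate_in_\<G>:
  assumes "certificate x" "\<forall>i\<in>E. R i x = b $ i"
  shows "x \<in> \<G> E"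
  using assms by (auto simp: certificate_def \<G>_def)

lemma tight_if_maximum_is_bound:
  assumes "x \<in> \<G> E" "i \<notin> E" "optimal_value (Sub_LP E i) = ereal (b $ i)"
  shows "R i x = b $ i"
proof (rule antisym)
  have "ereal (R i x) \<le> optimal_value (Sub_LP E i)"
    unfolding optimal_value_def feasible_points_Sub_LP
    using assms(1) by (intro SUP_upper2[of x]) (auto simp: Sub_LP_def)
  then show "R i x \<le> b $ i"
    using assms(3) by simp
qed (use assms in \<open>auto simp: \<G>_def\<close>)

text \<open>A positive \<open>t\<close> excludes tight rows outside \<open>E\<close>, so the derivative conditions imposed on \<open>E\<close> are
  all that a certificate asks for.\<close>

lemma certificate_of_positive_slack:
  assumes "(x, t) \<in> feasible_points (LP E)" "0 < t"
  shows "certificate x"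
proof -
  have "b $ i \<le> R i x \<and> (R i x = b $ i \<longrightarrow> (\<forall>l<length vs. 0 \<le> D i l x))" for i
  proof (cases "i \<in> E")
    case True
    then show ?thesis
      using assms by (auto simp: feasible_points_LP \<G>_def)
  next
    case False
    then have "b $ i + t \<le> R i x"
      using assms by (simp add: feasible_points_LP)
    then show ?thesis
      using assms by auto
  qed
  then show ?thesis
    by (simp add: certificate_def)
qed

lemma certificate_of_all_active: "x \<in> \<G> UNIV \<Longrightarrow> certificate x"
  by (auto simp: \<G>_def certificate_def)

section \<open>Termination, program count and correctness of the run\<close>

definition small_lps ::
  "((('r, 'd) affine_rule \<times> real) max_problem + ('r, 'd) affine_rule max_problem) multiset \<Rightarrow> bool"
  where
  "small_lps M \<longleftrightarrow>
     (\<forall>P. Inl P \<in># M \<longrightarrow>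
        lp_bounded_by (CARD('r) * CARD('d) + CARD('r) + 1)
          (CARD('m) * length vs + CARD('m) + 1) P) \<and>
     (\<forall>P. Inr P \<in># M \<longrightarrow>
        lp_bounded_by (CARD('r) * CARD('d) + CARD('r) + 1)
          (CARD('m) * length vs + CARD('m) + 1) P)"

lemma small_lps_add_LP [simp]: "small_lps (add_mset (Inl (LP E)) M) \<longleftrightarrow> small_lps M"
  unfolding small_lps_def using lp_bounded_LP by auto

lemma small_lps_add_Sub_LPs [simp]:
  "small_lps (M + {# Inr (Sub_LP E i). i \<in># mset_set I #}) \<longleftrightarrow> small_lps M"
  unfolding small_lps_def using lp_bounded_Sub_LP by (cases "finite I") auto

text \<open>The second conjunct is the reason for correctness: the active rows are tight for all
  certificates. While the loop runs, both counters are bounded in terms of the number of active rows,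
  which each completed iteration increases; after a return in the loop only the final bounds are
  kept.\<close>

definition loop_invariant :: "('m, 'r, 'd) state \<Rightarrow> bool" where
  "loop_invariant s \<longleftrightarrow>
     small_lps (solved s) \<and>
     (\<forall>x. certificate x \<longrightarrow> (\<forall>i\<in>active s. R i x = b $ i)) \<and>
     (case returned s of
        None \<Rightarrow> iterations s \<le> card (active s) \<and>
          size (solved s) \<le> lp_budget CARD('m) (card (active s))
      | Some r \<Rightarrow> iterations s \<le> CARD('m) \<and> size (solved s) \<le> lp_budget CARD('m) CARD('m) \<and>
          r \<in> {R1, R2} \<and> (says_feasible r \<longleftrightarrow> (\<exists>x. certificate x)))"

text \<open>A returning iteration decides the existence of certificates by the program it has solved. In the
  remaining case there is a new row, and the maxima of the sub-programs show that all new rows are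
  tight for every certificate.\<close>

lemma loop_body_invariant:
  assumes inv: "loop_invariant s" and running: "returned s = None" "card (active s) < CARD('m)"
  shows "loop_invariant (loop_body s) \<and>
    (returned (loop_body s) = None \<longrightarrow> card (active s) < card (active (loop_body s)))"
proof -
  let ?E = "active s" and ?m = "CARD('m)"
  have small: "small_lps (solved s)"
    and tight: "\<And>x i. certificate x \<Longrightarrow> i \<in> ?E \<Longrightarrow> R i x = b $ i"
    and iter: "iterations s \<le> card ?E"
    and size: "size (solved s) \<le> lp_budget ?m (card ?E)"
    using inv running(1) by (auto simp: loop_invariant_def)
  have small_Inl: "small_lps (solved s + {# Inl (LP ?E) #})"
    using small by simp
  have size_Inl: "size (solved s + {# Inl (LP ?E) #}) \<le> lp_budget ?m ?m"
    using size lp_budget_step[OF running(2), of ?m] running(2) by simp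
  consider (infeasible) "\<not> lp_feasible (LP ?E)"
    | (slack) "lp_feasible (LP ?E)" "0 < optimal_value (LP ?E)"
    | (grow) "lp_feasible (LP ?E)" "\<not> 0 < optimal_value (LP ?E)"
    by blast
  then show ?thesis
  proof cases
    case infeasible
    then have "\<G> ?E = {}"
      by (simp add: lp_feasible_LP)
    then have "\<not> (\<exists>x. certificate x)"
      using tight certificate_in_\<G>[of _ ?E] by blast
    then show ?thesis
      using infeasible small_Inl size_Inl tight iter running(2)
      by (auto simp: loop_body_def Let_def loop_invariant_def)
  next
    case slack
    then have "\<exists>x. certificate x"
      using certificate_of_positive_slack unfolding optimal_value_LP_pos by blast
    then show ?thesis
      using slack small_Inl size_Inl tight iter running(2)
      by (auto simp: loop_body_def Let_def loop_invariant_def)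
  next
    case grow
    define N where "N = {i. i \<notin> ?E \<and> optimal_value (Sub_LP ?E i) = ereal (b $ i)}"
    define M where "M = solved s + {# Inl (LP ?E) #} + {# Inr (Sub_LP ?E i). i \<in># mset_set (- ?E) #}"
    have body: "loop_body s =
        s\<lparr> iterations := iterations s + 1, active := ?E \<union> N, solved := M \<rparr>"
      using grow by (simp add: loop_body_def Let_def N_def M_def)
    have "?E \<noteq> UNIV"
      using running(2) by auto
    then have "N \<noteq> {}"
      using active_set_grows[OF grow] by (auto simp: N_def)
    then have card: "card ?E < card (?E \<union> N)"
      by (intro psubset_card_mono) (auto simp: N_def)
    have "R i x = b $ i" if "certificate x" "i \<in> ?E \<union> N" for x i
    proof (cases "i \<in> ?E")
      case False
      then show ?thesis
        using that tight certificate_in_\<G> by (intro tight_if_maximum_is_bound[of _ ?E]) (auto simp: N_def)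
    qed (use tight that in blast)
    moreover have "small_lps M"
      unfolding M_def using small by (simp del: union_mset_add_mset_left)
    moreover have "size M \<le> lp_budget ?m (card (?E \<union> N))"
    proof -
      have "size M = size (solved s) + (?m + 1 - card ?E)"
        using running(2) by (simp add: M_def card_Compl)
      then show ?thesis
        using size lp_budget_step[OF card, of ?m] by linarith
    qed
    ultimately show ?thesis
      using card iter running(1) by (auto simp: body loop_invariant_def)
  qed
qed

lemma loop_terminates:
  "\<exists>s. loop = Some s \<and> loop_invariant s \<and> (returned s = None \<longrightarrow> active s = UNIV)"
proof -
  let ?running = "\<lambda>s :: ('m, 'r, 'd) state. returned s = None \<and> card (active s) < CARD('m)"
  have init: "loop_invariant initial"
    by (simp add: loop_invariant_def initial_def small_lps_def)
  let ?variant = "\<lambda>s :: ('m, 'r, 'd) state.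
    if returned s = None then CARD('m) + 1 - card (active s) else 0"
  have "\<exists>s. loop = Some s"
    unfolding loop_def
  proof (rule measure_while_option_Some[where P = loop_invariant and f = ?variant])
    fix s assume "loop_invariant s" "?running s"
    then show "loop_invariant (loop_body s) \<and> ?variant (loop_body s) < ?variant s"
      using loop_body_invariant[of s] by auto
  qed (rule init)
  then obtain s where s: "loop = Some s"
    by blast
  have "loop_invariant s"
  proof (rule while_option_rule[where P = loop_invariant, OF _ s[unfolded loop_def] init])
    fix s' assume "loop_invariant s'" "?running s'"
    then show "loop_invariant (loop_body s')"
      using loop_body_invariant[of s'] by blast
  qed
  moreover have "active s = UNIV" if "returned s = None"
  proof -
    have "\<not> card (active s) < CARD('m)"
      using while_option_stop[OF s[unfolded loop_def]] that by auto
    then show ?thesis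
      using card_seteq[of UNIV "active s"] by auto
  qed
  ultimately show ?thesis
    using s by simp
qed

lemma after_loop_correct:
  assumes "loop_invariant s" "returned s = None" "active s = UNIV"
  shows "size (solved (after_loop s)) \<le> (CARD('m) + 2) * (CARD('m) + 1) div 2"
    and "small_lps (solved (after_loop s))"
    and "\<exists>r\<in>{R3, R4}. returned (after_loop s) = Some r \<and> (says_feasible r \<longleftrightarrow> (\<exists>x. certificate x))"
proof -
  have solved: "solved (after_loop s) = solved s + {# Inl (LP UNIV) #}"
    using assms by (simp add: after_loop_def)
  show "size (solved (after_loop s)) \<le> (CARD('m) + 2) * (CARD('m) + 1) div 2"
    using assms unfolding lp_budget_total[symmetric] solved by (simp add: loop_invariant_def)
  show "small_lps (solved (after_loop s))"
    using assms(1) unfolding solved by (simp add: loop_invariant_def)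
  have "lp_feasible (LP UNIV) \<longleftrightarrow> (\<exists>x. certificate x)"
  proof
    assume "\<exists>x. certificate x"
    then obtain x where "certificate x"
      by blast
    moreover from this have "\<forall>i\<in>UNIV. R i x = b $ i"
      using assms(1,3) by (simp add: loop_invariant_def del: split_paired_All)
    ultimately have "x \<in> \<G> UNIV"
      by (rule certificate_in_\<G>)
    then show "lp_feasible (LP UNIV)"
      by (auto simp: lp_feasible_LP)
  qed (use certificate_of_all_active in \<open>auto simp: lp_feasible_LP\<close>)
  then show "\<exists>r\<in>{R3, R4}. returned (after_loop s) = Some r \<and> (says_feasible r \<longleftrightarrow> (\<exists>x. certificate x))"
    using assms by (auto simp: after_loop_def)
qed

section \<open>Certificates and local linear feasibility\<close>

text \<open>This separates the residual at \<open>\<zeta>\<close> from the linear part, which the edge directions control.\<close>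

lemma recourse_row:
  "(W *v (y + Y *v \<xi>) + H *v \<xi>) $ i
     = R i (Y, y) + (W $ i \<bullet> (Y *v (\<xi> - \<zeta>)) + H $ i \<bullet> (\<xi> - \<zeta>))"
  by (simp add: R_def matrix_vector_mul_component matrix_vector_mult_diff_distrib inner_simps)

text \<open>Tight rows are handled on all of \<open>\<Xi>\<close>, as the directions in which a row does not decrease form a
  convex cone containing the edge directions; rows with slack need a small ball.\<close>

lemma certificate_imp_locally_linear_feasible:
  assumes "certificate (Y, y)"
    and "\<And>\<xi>. \<xi> \<in> \<Xi> \<Longrightarrow> \<xi> - \<zeta> \<in> convex_cone hull (set vs)"
  shows "locally_linear_feasible W H b \<Xi> \<zeta>"
proof -
  let ?row = "\<lambda>i \<xi>. (W *v (y + Y *v \<xi>) + H *v \<xi>) $ i"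
  have "\<forall>\<^sub>F \<xi> in nhds \<zeta>. \<xi> \<in> \<Xi> \<longrightarrow> b $ i \<le> ?row i \<xi>" for i
  proof (cases "R i (Y, y) = b $ i")
    case True
    let ?K = "{v. 0 \<le> W $ i \<bullet> (Y *v v) + H $ i \<bullet> v}"
    have "set vs \<subseteq> ?K"
      using assms(1) True by (auto simp: certificate_def D_def in_set_conv_nth)
    moreover have "convex_cone ?K"
    proof -
      have "W $ i \<bullet> (Y *v (c *\<^sub>R v)) + H $ i \<bullet> (c *\<^sub>R v) = c * (W $ i \<bullet> (Y *v v) + H $ i \<bullet> v)" for c v
        by (simp add: matrix_vector_mult_scaleR distrib_left)
      then show ?thesis
        by (auto simp: convex_cone_iff matrix_vector_right_distrib inner_add_right)
    qed
    ultimately have "convex_cone hull (set vs) \<subseteq> ?K"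
      by (rule hull_minimal)
    then have "\<xi> - \<zeta> \<in> ?K" if "\<xi> \<in> \<Xi>" for \<xi>
      using assms(2)[OF that] by blast
    then show ?thesis
      unfolding recourse_row True by (intro always_eventually) auto
  next
    case False
    then have "b $ i < ?row i \<zeta>"
      using assms(1) unfolding recourse_row by (auto simp: certificate_def less_le)
    moreover have "(?row i \<longlongrightarrow> ?row i \<zeta>) (nhds \<zeta>)"
      by (intro tendsto_vec_nth tendsto_add tendsto_const filterlim_ident
          bounded_linear.tendsto[OF matrix_vector_mul_bounded_linear])
    ultimately have "\<forall>\<^sub>F \<xi> in nhds \<zeta>. b $ i < ?row i \<xi>"
      by (rule order_tendstoD(1)[rotated])
    then show ?thesis
      by eventually_elim simp
  qed
  then have "\<forall>\<^sub>F \<xi> in nhds \<zeta>. \<forall>i. \<xi> \<in> \<Xi> \<longrightarrow> b $ i \<le> ?row i \<xi>"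
    by (rule eventually_all_finite)
  then obtain \<epsilon> where "\<epsilon> > 0" "\<And>\<xi>. dist \<xi> \<zeta> < \<epsilon> \<Longrightarrow> \<forall>i. \<xi> \<in> \<Xi> \<longrightarrow> b $ i \<le> ?row i \<xi>"
    by (auto simp: eventually_nhds_metric)
  then show ?thesis
    unfolding locally_linear_feasible_def less_eq_vec_def
    by (intro exI[of _ \<epsilon>] exI[of _ y] exI[of _ Y] conjI) (auto simp: dist_commute)
qed

text \<open>Evaluate the rule at \<open>\<zeta>\<close> for the weak inequalities, and for a tight row at a point
  \<open>\<zeta> + t *\<^sub>R v\<close> with \<open>v\<close> an edge direction and \<open>t\<close> small.\<close>

lemma locally_linear_feasible_imp_certificate:
  assumes "convex \<Xi>" "\<zeta> \<in> \<Xi>" "set vs \<subseteq> feasible_directions \<Xi> \<zeta>"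
    and "locally_linear_feasible W H b \<Xi> \<zeta>"
  obtains x where "certificate x"
proof -
  obtain \<epsilon> Y y where "\<epsilon> > 0"
    and local: "\<forall>\<xi>\<in>\<Xi> \<inter> ball \<zeta> \<epsilon>. \<forall>i. b $ i \<le> (W *v (y + Y *v \<xi>) + H *v \<xi>) $ i"
    using assms(4) unfolding locally_linear_feasible_def less_eq_vec_def by blast
  have feas: "b $ i \<le> (W *v (y + Y *v \<xi>) + H *v \<xi>) $ i" if "\<xi> \<in> \<Xi>" "dist \<zeta> \<xi> < \<epsilon>" for \<xi> i
    using bspec[OF local, of \<xi>] that by simp
  have "0 \<le> D i l (Y, y)" if "R i (Y, y) = b $ i" "l < length vs" for i l
  proof -
    let ?v = "vs ! l"
    obtain \<delta> where "\<delta> > 0" "\<zeta> + \<delta> *\<^sub>R ?v \<in> \<Xi>"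
      using assms(3) nth_mem[OF \<open>l < length vs\<close>] by (auto simp: feasible_directions_def)
    \<comment> \<open>The denominator is increased by 1 because \<open>norm ?v\<close> may a priori be 0.\<close>
    moreover obtain t where t: "0 < t" "t < \<delta>" "t < \<epsilon> / (norm ?v + 1)"
      using field_lbound_gt_zero[of \<delta> "\<epsilon> / (norm ?v + 1)"] \<open>\<delta> > 0\<close> \<open>\<epsilon> > 0\<close>
      by (auto simp: add_nonneg_pos)
    ultimately have "\<zeta> + t *\<^sub>R ?v \<in> \<Xi>"
      using feasible_direction_shrink[OF assms(1,2)] by (meson less_imp_le)
    moreover have "t * norm ?v + t < \<epsilon>"
      using t(3) by (simp add: pos_less_divide_eq add_nonneg_pos distrib_left)
    then have "dist \<zeta> (\<zeta> + t *\<^sub>R ?v) < \<epsilon>"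
      using t(1) by (simp add: dist_norm)
    ultimately have "b $ i \<le> R i (Y, y) + (W $ i \<bullet> (Y *v (t *\<^sub>R ?v)) + H $ i \<bullet> (t *\<^sub>R ?v))"
      using feas[of "\<zeta> + t *\<^sub>R ?v" i] unfolding recourse_row by simp
    then have "0 \<le> t * D i l (Y, y)"
      using that(1) by (simp add: D_def matrix_vector_mult_scaleR distrib_left)
    then show ?thesis
      using t(1) by (simp add: zero_le_mult_iff)
  qed
  moreover have "b $ i \<le> R i (Y, y)" for i
    using feas[OF assms(2), of i] \<open>\<epsilon> > 0\<close> unfolding recourse_row by simp
  ultimately have "certificate (Y, y)"
    by (simp add: certificate_def)
  then show thesis
    by (rule that)
qed

end

lemma locally_linear_feasible_iff_certificate:
  fixes W :: "real^'r^'m"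
  assumes "polyhedron \<Xi>" "\<zeta> extreme_point_of \<Xi>" "edge_directions \<Xi> \<zeta> vs"
  shows "locally_linear_feasible W H b \<Xi> \<zeta> \<longleftrightarrow> (\<exists>x. recourse.certificate W H b \<zeta> vs x)"
proof
  assume "locally_linear_feasible W H b \<Xi> \<zeta>"
  moreover have "\<zeta> \<in> \<Xi>"
    using assms(2) by (simp add: extreme_point_of_def)
  moreover have "set vs \<subseteq> feasible_directions \<Xi> \<zeta>"
    using edge_directions_sound[OF assms(3)] by blast
  ultimately show "\<exists>x. recourse.certificate W H b \<zeta> vs x"
    by (meson recourse.locally_linear_feasible_imp_certificate[OF polyhedron_imp_convex[OF assms(1)]])
next
  assume "\<exists>x. recourse.certificate W H b \<zeta> vs x"
  then obtain Y y where "recourse.certificate W H b \<zeta> vs (Y, y)"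
    by auto
  then show "locally_linear_feasible W H b \<Xi> \<zeta>"
    using edge_directions_generate[OF assms]
    by (rule recourse.certificate_imp_locally_linear_feasible)
qed

theorem theorem5:
  fixes \<Xi> :: "(real^'d) set"
    and \<zeta> :: "real^'d"
    and vs :: "(real^'d) list"
    and W :: "real^'r^'m"
    and H :: "real^'d^'m"
    and b :: "real^'m"
  assumes "polyhedron \<Xi>"
    and "\<zeta> extreme_point_of \<Xi>"
    and "edge_directions \<Xi> \<zeta> vs"
  shows
    "(\<exists>s. recourse.loop W H b \<zeta> vs = Some s \<and> iterations s \<le> CARD('m) \<and>
          (returned s \<in> {Some R1, Some R2} \<or>
           returned s = None \<and>
           returned (recourse.after_loop W H b \<zeta> vs s) \<in> {Some R3, Some R4})) \<and>
     (\<exists>s. recourse.algorithm W H b \<zeta> vs = Some s \<and>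
          size (solved s) \<le> (CARD('m) + 2) * (CARD('m) + 1) div 2 \<and>
          (\<forall>P. Inl P \<in># solved s \<longrightarrow>
             lp_bounded_by (CARD('r) * CARD('d) + CARD('r) + 1)
               (CARD('m) * length vs + CARD('m) + 1) P) \<and>
          (\<forall>P. Inr P \<in># solved s \<longrightarrow>
             lp_bounded_by (CARD('r) * CARD('d) + CARD('r) + 1)
               (CARD('m) * length vs + CARD('m) + 1) P)) \<and>
     (recourse.returns_feasible W H b \<zeta> vs \<longleftrightarrow> locally_linear_feasible W H b \<Xi> \<zeta>)"
proof -
  interpret recourse W H b \<zeta> vs .
  obtain s where s: "loop = Some s" and inv: "loop_invariant s"
    and "returned s = None \<longrightarrow> active s = UNIV"
    using loop_terminates by (elim exE conjE)
  then have all_active: "active s = UNIV" if "returned s = None"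
    using that by simp
  have "algorithm = Some (after_loop s)"
    by (simp add: algorithm_def s)
  have final: "size (solved (after_loop s)) \<le> (CARD('m) + 2) * (CARD('m) + 1) div 2 \<and>
      small_lps (solved (after_loop s)) \<and>
      (\<exists>r. returned (after_loop s) = Some r \<and> (says_feasible r \<longleftrightarrow> (\<exists>x. certificate x)))"
  proof (cases "returned s")
    case None
    then show ?thesis
      using after_loop_correct[OF inv None all_active[OF None]] by blast
  next
    case (Some r)
    then have "after_loop s = s"
      by (simp add: after_loop_def)
    then show ?thesis
      using inv Some unfolding lp_budget_total[symmetric] by (simp add: loop_invariant_def)
  qed
  have "iterations s \<le> CARD('m)"
    using inv card_mono[of UNIV "active s"]
    by (auto simp: loop_invariant_def split: option.splits)
  moreover have "returned s \<in> {Some R1, Some R2} \<or>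
      returned s = None \<and> returned (after_loop s) \<in> {Some R3, Some R4}"
  proof (cases "returned s")
    case None
    then show ?thesis
      using after_loop_correct(3)[OF inv None all_active[OF None]] None by auto
  next
    case (Some r)
    then show ?thesis
      using inv by (auto simp: loop_invariant_def)
  qed
  moreover have "returns_feasible \<longleftrightarrow> locally_linear_feasible W H b \<Xi> \<zeta>"
    using final \<open>algorithm = _\<close> locally_linear_feasible_iff_certificate[OF assms, of W H b]
    by (auto simp: returns_feasible_def)
  ultimately show ?thesis
    using s final \<open>algorithm = _\<close> unfolding small_lps_def by blast
qed

end
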